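(* Let $k>1$ be an odd integer and let $q>2$ be an integer with $4\nmid q$. Then the $\mathbb{Q}$-vector space spanned by the numbers $$\frac{\zeta(k,a/q)-\zeta(k,1-a/q)}{\pi^k},\qquad 1\le a<q/2,\ \gcd(a,q)=1,$$ intersects $\mathbb{Q}$ trivially (i.e. the intersection is $\{0\}$).
   Context: For $0<x\le1$ and $\Re(s)>1$, the Hurwitz zeta function is $\zeta(s,x)=\sum_{n\ge0}(n+x)^{-s}$. *)

theory Defs
  imports "HOL-Analysis.Complex_Transcendental"
begin

text \<open>
  Intended for \<open>0 < x \<le> 1\<close> and \<open>Re s > 1\<close>, where the series converges. The base of each term is
  then a positive real, so that the principal branch used by \<open>powr\<close> is the usual power.
\<close>
definition hurwitz_zeta :: "complex \<Rightarrow> real \<Rightarrow> complex" where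
  "hurwitz_zeta s x = (\<Sum>n. (of_nat n + of_real x) powr (- s))"

text \<open>The complex numbers as a vector space over the rationals.\<close>
global_interpretation rat_complex: vector_space "\<lambda>(r::rat) (z::complex). of_rat r * z"
  defines rat_span = rat_complex.span
  by unfold_locales (simp_all add: algebra_simps of_rat_add of_rat_mult)

end

theory Submission
  imports
    Defs
    "HOL-Analysis.Gamma_Function"
    "HOL-Computational_Algebra.Field_as_Ring"
    "HOL-Computational_Algebra.Polynomial_Factorial"
    "HOL-Number_Theory.Cong"
    "HOL-Library.Real_Mod"
begin

text \<open>
  For odd \<open>k\<close> the difference \<open>\<zeta>(k, x) - \<zeta>(k, 1 - x)\<close> is, up to a rational factor, the
  \<open>(k-1)\<close>-st derivative of \<open>\<pi> cot (\<pi> x)\<close>, that is, \<open>\<pi>^k\<close> times an odd rational polynomial in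
  \<open>cot (\<pi> x)\<close>. At \<open>x = a/q\<close> the cotangent lies in \<open>\<i> \<rat>(e^(2\<pi>\<i>/q))\<close>, hence so does the whole span.
  A nonzero rational number in it would put \<open>\<i>\<close> into \<open>\<rat>(e^(2\<pi>\<i>/q))\<close>. Since \<open>4\<close> does not divide \<open>q\<close>,
  this field is generated by a root of unity \<open>\<zeta>\<close> of odd order \<open>m\<close>. Inverting a discrete Fourier
  transform gives \<open>m \<i> \<in> \<int>[\<zeta>]\<close>, and a power \<open>y \<mapsto> y^e\<close> of the Frobenius modulo 2 that fixes \<open>\<zeta>\<close>
  shows \<open>m^e - m \<i> \<in> 2 \<int>[\<zeta>]\<close>. The product of this number with its conjugate is then in
  \<open>4 \<int>[\<zeta>] \<inter> \<int> = 4 \<int>\<close>, but it equals \<open>m^(2e) + m^2\<close>, which is 2 modulo 4.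
\<close>

section \<open>Adjoining a complex number to a ring\<close>

text \<open>Stated for a general coefficient ring so that \<int>[z] and \<rat>[z], both written
  \<open>adjoin z\<close>, share one development.\<close>

locale complex_ring_hom =
  fixes h :: "'a :: comm_ring_1 \<Rightarrow> complex"
  assumes h_add: "h (x + y) = h x + h y"
    and h_mult: "h (x * y) = h x * h y"
    and h_1: "h 1 = 1"
begin

definition ev :: "'a poly \<Rightarrow> complex \<Rightarrow> complex" where
  "ev p z = poly (map_poly h p) z"

definition adjoin :: "complex \<Rightarrow> complex set" where
  "adjoin z = range (\<lambda>p. ev p z)"

lemma h_0 [simp]: "h 0 = 0"
  using h_add[of 0 0] by simp

lemma h_sum: "h (sum f A) = (\<Sum>x\<in>A. h (f x))"
  by (induction A rule: infinite_finite_induct) (auto simp: h_add)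

lemma ev_0 [simp]: "ev 0 z = 0"
  by (simp add: ev_def)

lemma ev_pCons [simp]: "ev (pCons a p) z = h a + z * ev p z"
  by (simp add: ev_def map_poly_pCons)

lemma ev_1 [simp]: "ev 1 z = 1"
  by (simp add: one_pCons h_1)

lemma ev_add [simp]: "ev (p + q) z = ev p z + ev q z"
proof -
  have "map_poly h (p + q) = map_poly h p + map_poly h q"
    by (rule poly_eqI) (simp add: coeff_map_poly h_add)
  thus ?thesis by (simp add: ev_def)
qed

lemma ev_uminus [simp]: "ev (- p) z = - ev p z"
  using ev_add[of p "-p" z] by (simp add: add_eq_0_iff del: ev_add)

lemma ev_diff [simp]: "ev (p - q) z = ev p z - ev q z"
  using ev_add[of p "-q" z] by simp

lemma ev_mult [simp]: "ev (p * q) z = ev p z * ev q z"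
proof -
  have "map_poly h (p * q) = map_poly h p * map_poly h q"
    by (rule poly_eqI) (simp add: coeff_map_poly coeff_mult h_sum h_mult)
  thus ?thesis by (simp add: ev_def)
qed

lemma ev_smult [simp]: "ev (smult c p) z = h c * ev p z"
  using ev_mult[of "[:c:]" p z] by simp

lemma ev_power [simp]: "ev (p ^ n) z = ev p z ^ n"
  by (induction n) auto

lemma ev_monom [simp]: "ev (monom c n) z = h c * z ^ n"
  by (simp add: ev_def map_poly_monom poly_monom)

lemma ev_pcompose [simp]: "ev (pcompose p q) z = ev p (ev q z)"
  by (induction p) (auto simp: pcompose_pCons)

lemma ev_sum: "ev (sum f A) z = (\<Sum>x\<in>A. ev (f x) z)"
  by (induction A rule: infinite_finite_induct) auto

lemma ev_altdef:
  assumes "degree p < n"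
  shows "ev p z = (\<Sum>i<n. h (coeff p i) * z ^ i)"
proof -
  have "p = (\<Sum>i<n. monom (coeff p i) i)"
    using assms poly_as_sum_of_monoms'[of p "n - 1"]
    by (cases n) (auto simp: lessThan_Suc_atMost)
  hence "ev p z = ev (\<Sum>i<n. monom (coeff p i) i) z" by (rule arg_cong)
  also have "\<dots> = (\<Sum>i<n. ev (monom (coeff p i) i) z)"
    by (rule ev_sum)
  finally show ?thesis by simp
qed

lemma adjoin_ev [intro]: "ev p z \<in> adjoin z"
  by (auto simp: adjoin_def)

lemma adjoinE: "x \<in> adjoin z \<Longrightarrow> (\<And>p. x = ev p z \<Longrightarrow> thesis) \<Longrightarrow> thesis"
  by (auto simp: adjoin_def)

lemma adjoin_add [intro]: "x \<in> adjoin z \<Longrightarrow> y \<in> adjoin z \<Longrightarrow> x + y \<in> adjoin z"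
  by (metis adjoin_ev adjoinE ev_add)

lemma adjoin_mult [intro]: "x \<in> adjoin z \<Longrightarrow> y \<in> adjoin z \<Longrightarrow> x * y \<in> adjoin z"
  by (metis adjoin_ev adjoinE ev_mult)

lemma adjoin_minus [intro]: "x \<in> adjoin z \<Longrightarrow> - x \<in> adjoin z"
  by (metis adjoin_ev adjoinE ev_uminus)

lemma adjoin_base [intro]: "h c \<in> adjoin z"
  using adjoin_ev[of "[:c:]" z] by simp

lemma adjoin_0 [intro, simp]: "0 \<in> adjoin z" and adjoin_1 [intro, simp]: "1 \<in> adjoin z"
  using adjoin_base[of 0 z] adjoin_base[of 1 z] by (auto simp: h_1)

lemma adjoin_gen [intro, simp]: "z \<in> adjoin z"
  using adjoin_ev[of "[:0, 1:]" z] by (simp add: h_1)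

lemma adjoin_power [intro]: "x \<in> adjoin z \<Longrightarrow> x ^ n \<in> adjoin z"
  by (induction n) auto

lemma adjoin_sum [intro]: "(\<And>i. i \<in> A \<Longrightarrow> f i \<in> adjoin z) \<Longrightarrow> sum f A \<in> adjoin z"
  by (induction A rule: infinite_finite_induct) auto

lemma adjoin_poly: "x \<in> adjoin z \<Longrightarrow> ev p x \<in> adjoin z"
  by (induction p) auto

lemma adjoin_trans: "x \<in> adjoin y \<Longrightarrow> y \<in> adjoin z \<Longrightarrow> x \<in> adjoin z"
  by (metis adjoinE adjoin_poly)

end

global_interpretation Z: complex_ring_hom "of_int"
  by unfold_locales auto

global_interpretation Q: complex_ring_hom "of_rat"
  by unfold_locales (auto simp: of_rat_add of_rat_mult)

section \<open>Roots of unity and the imaginary unit\<close>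

text \<open>With x = a/b in lowest terms, b^e divides n for every e; since n < 2^n, the exponent e =
  n already forces b = 1.\<close>

lemma Ints_if_bounded_denominators:
  fixes x :: complex
  assumes "x \<in> \<rat>" and "n > 0" and int: "\<And>e. of_nat n * x ^ e \<in> \<int>"
  shows "x \<in> \<int>"
proof -
  from assms(1) obtain r :: rat where r: "x = of_rat r" by (auto elim: Rats_cases)
  obtain a b where ab: "quotient_of r = (a, b)" by force
  have b: "b > 0" and cop: "coprime a b" and rab: "r = of_int a / of_int b"
    using quotient_of_denom_pos[OF ab] quotient_of_coprime[OF ab] quotient_of_div[OF ab] by auto
  have xab: "x = of_int a / of_int b" by (simp add: r rab of_rat_divide)
  from int[of n] obtain c where "of_nat n * x ^ n = of_int c" by (auto elim: Ints_cases)
  hence "of_int (int n * a ^ n) = (of_int (c * b ^ n) :: complex)"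
    using b by (simp add: xab power_divide field_simps)
  hence "int n * a ^ n = c * b ^ n" by (simp only: of_int_eq_iff)
  hence "b ^ n dvd int n * a ^ n" by simp
  moreover have "coprime (b ^ n) (a ^ n)" using cop by (simp add: coprime_commute)
  ultimately have "b ^ n dvd int n" by (simp add: coprime_dvd_mult_left_iff)
  hence le: "b ^ n \<le> int n" using \<open>n > 0\<close> by (intro zdvd_imp_le) auto
  have "b = 1"
  proof (rule ccontr)
    assume "b \<noteq> 1"
    hence "b \<ge> 2" using b by simp
    hence "2 ^ n \<le> b ^ n" by (intro power_mono) auto
    moreover have "int n < 2 ^ n" by (metis of_nat_less_iff of_nat_less_two_power)
    ultimately show False using le by linarith
  qed
  thus ?thesis by (simp add: xab)
qed

lemma common_denominator:
  fixes f :: "nat \<Rightarrow> complex"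
  assumes "\<And>j. j < N \<Longrightarrow> f j \<in> \<rat>"
  shows "\<exists>n>0. \<forall>j<N. of_nat n * f j \<in> \<int>"
  using assms
proof (induction N)
  case (Suc N)
  then obtain n where n: "n > 0" "\<And>j. j < N \<Longrightarrow> of_nat n * f j \<in> \<int>" by force
  obtain r :: rat where r: "f N = of_rat r" using Suc.prems[of N] by (auto elim: Rats_cases)
  obtain a b where ab: "quotient_of r = (a, b)" by force
  have b: "b > 0" and rab: "r = of_int a / of_int b"
    using quotient_of_denom_pos[OF ab] quotient_of_div[OF ab] by auto
  have fN: "f N = of_int a / of_int b" by (simp add: r rab of_rat_divide)
  have bb: "(of_nat (nat b) :: complex) = of_int b" using b by simp
  show ?case
  proof (intro exI[of _ "n * nat b"] conjI allI impI)
    fix j assume "j < Suc N"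
    then consider "j < N" | "j = N" by linarith
    thus "of_nat (n * nat b) * f j \<in> \<int>"
    proof cases
      case 1
      have "of_nat (n * nat b) * f j = of_int b * (of_nat n * f j)" using bb by simp
      thus ?thesis using n(2)[OF 1] by (metis Ints_mult Ints_of_int)
    next
      case 2
      have "of_nat (n * nat b) * f j = of_nat n * of_int a" using b bb by (simp add: 2 fN)
      thus ?thesis by (metis Ints_mult Ints_of_int Ints_of_nat)
    qed
  qed (use n b in auto)
qed auto

lemma power_mod_root:
  fixes w :: complex
  assumes "w ^ N = 1"
  shows "w ^ j = w ^ (j mod N)"
  by (metis assms mult.right_neutral mult_div_mod_eq power_add power_mult power_one mult.left_neutral)

text \<open>
  A \<open>\<rat>\<close>-linear functional with value \<open>1\<close> at \<open>1\<close> has bounded denominators on \<open>\<int>[w]\<close> and fixes every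
  power of \<open>x\<close>.
\<close>
lemma rat_in_adjoin_root_of_unity:
  assumes w: "w ^ N = 1" and N: "N > 0" and x: "x \<in> Z.adjoin w" "x \<in> \<rat>"
  shows "x \<in> \<int>"
proof -
  interpret vp: vector_space_pair "\<lambda>(r::rat) (z::complex). of_rat r * z" "\<lambda>(r::rat) (z::complex). of_rat r * z"
    by unfold_locales
  have ind: "rat_complex.independent {1}"
    by simp
  \<comment> \<open>\<open>\<phi>\<close> is 1 at 1 and 0 on the other vectors of a \<rat>-basis
    extending \<open>{1}\<close>, so all its values are rational.\<close>
  define \<phi> where "\<phi> = vp.construct {1} (\<lambda>_. 1)"
  interpret \<phi>: Vector_Spaces.linear "\<lambda>(r::rat) (z::complex). of_rat r * z" "\<lambda>(r::rat) (z::complex). of_rat r * z" \<phi>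
    unfolding \<phi>_def by (rule vp.linear_construct[OF ind])
  have \<phi>1: "\<phi> 1 = 1"
    unfolding \<phi>_def by (rule vp.construct_basis[OF ind]) simp
  have \<phi>_rat: "\<phi> v \<in> \<rat>" for v
    using vp.construct_in_span[OF ind, of "\<lambda>_. 1" v]
    by (auto simp: \<phi>_def rat_complex.span_singleton)
  have \<phi>_scale: "\<phi> (of_int c * v) = of_int c * \<phi> v" for c v
    using \<phi>.scale[of "of_int c" v] by simp
  obtain n where n: "n > 0" "\<And>j. j < N \<Longrightarrow> of_nat n * \<phi> (w ^ j) \<in> \<int>"
    using common_denominator[of N "\<lambda>j. \<phi> (w ^ j)"] \<phi>_rat by blast
  \<comment> \<open>Exponents of \<open>w\<close> may be reduced modulo \<open>N\<close>, so a
    common denominator of finitely many values serves all of \<int>[w].\<close>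
  have int: "of_nat n * \<phi> y \<in> \<int>" if y: "y \<in> Z.adjoin w" for y
  proof -
    obtain p where p: "y = Z.ev p w" using y by (rule Z.adjoinE)
    have "y = (\<Sum>i<Suc (degree p). of_int (coeff p i) * w ^ i)"
      unfolding p by (rule Z.ev_altdef) simp
    hence "of_nat n * \<phi> y = (\<Sum>i<Suc (degree p). of_int (coeff p i) * (of_nat n * \<phi> (w ^ i)))"
      by (simp add: \<phi>.sum \<phi>.add \<phi>_scale sum_distrib_left mult.left_commute del: sum.lessThan_Suc)
    also have "\<dots> \<in> \<int>"
    proof (intro Ints_sum Ints_mult[OF Ints_of_int])
      fix i show "of_nat n * \<phi> (w ^ i) \<in> \<int>"
        using n(2)[of "i mod N"] N power_mod_root[OF w, of i] by simp
    qed
    finally show ?thesis .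
  qed
  show ?thesis
  proof (rule Ints_if_bounded_denominators[OF x(2) n(1)])
    fix e
    have "x ^ e \<in> \<rat>" using x(2) by simp
    then obtain r :: rat where "x ^ e = of_rat r" by (auto elim: Rats_cases)
    hence "\<phi> (x ^ e) = x ^ e" using \<phi>.scale[of r 1] \<phi>1 by simp
    thus "of_nat n * x ^ e \<in> \<int>" using int[of "x ^ e"] x(1) by (metis Z.adjoin_power)
  qed
qed

section \<open>The Frobenius modulo 2\<close>

text \<open>Modulo 2, squaring is additive and fixes integers. The correction \<open>g\<close> is
  uniform in \<open>z\<close> because the iteration applies the identity at powers of
  \<open>z\<close>.\<close>

lemma Z_frobenius_step: "\<exists>g. \<forall>z. Z.ev p z ^ 2 = Z.ev p (z ^ 2) + 2 * Z.ev g z"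
proof (induction p)
  case 0
  show ?case by (intro exI[of _ 0]) simp
next
  case (pCons a p)
  then obtain g where g: "\<And>z. Z.ev p z ^ 2 = Z.ev p (z ^ 2) + 2 * Z.ev g z" by blast
  have "even (a ^ 2 - a)" by simp
  then obtain b where "a ^ 2 - a = 2 * b" by (elim evenE)
  hence "of_int (a ^ 2 - a) = (of_int (2 * b) :: complex)" by (simp only:)
  hence b: "of_int a ^ 2 = (of_int a + 2 * of_int b :: complex)" by (simp add: algebra_simps)
  show ?case
  \<comment> \<open>The three summands come from a^2 = a + 2b, from the cross term 2 a z p(z), and
    from the induction hypothesis multiplied by z^2.\<close>
  proof (intro exI[of _ "[:b:] + pCons 0 ([:a:] * p) + pCons 0 (pCons 0 g)"] allI)
    fix z :: complex
    have "Z.ev (pCons a p) z ^ 2 = of_int a ^ 2 + 2 * of_int a * z * Z.ev p z + z ^ 2 * Z.ev p z ^ 2"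
      by (simp add: power2_eq_square algebra_simps)
    also have "\<dots> = of_int a + 2 * of_int b + 2 * of_int a * z * Z.ev p z
        + z ^ 2 * (Z.ev p (z ^ 2) + 2 * Z.ev g z)"
      by (simp only: b g)
    finally show "Z.ev (pCons a p) z ^ 2 = Z.ev (pCons a p) (z ^ 2)
        + 2 * Z.ev ([:b:] + pCons 0 ([:a:] * p) + pCons 0 (pCons 0 g)) z"
      by (simp add: power2_eq_square algebra_simps)
  qed
qed

lemma Z_frobenius: "\<exists>g. \<forall>z. Z.ev p z ^ (2 ^ s) = Z.ev p (z ^ (2 ^ s)) + 2 * Z.ev g z"
proof (induction s)
  case 0
  show ?case by (intro exI[of _ 0]) simp
next
  case (Suc s)
  then obtain g where g: "\<And>z. Z.ev p z ^ (2 ^ s) = Z.ev p (z ^ (2 ^ s)) + 2 * Z.ev g z" by blast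
  obtain f where f: "\<And>z. Z.ev p z ^ 2 = Z.ev p (z ^ 2) + 2 * Z.ev f z"
    using Z_frobenius_step[of p] by blast
  define X where "X = (monom 1 (2 ^ s) :: int poly)"
  show ?case
  \<comment> \<open>The single step at \<open>z ^ (2 ^ s)\<close> contributes
    \<open>pcompose f X\<close>; the rest comes from (A + 2 G)^2 = A^2 + 4 (A G + G^2).\<close>
  proof (intro exI[of _ "pcompose f X + 2 * (pcompose p X * g + g ^ 2)"] allI)
    fix z :: complex
    have two: "Z.ev 2 z = 2"
      using Z.ev_add[of 1 1 z] by simp
    have "Z.ev p z ^ (2 ^ Suc s) = (Z.ev p (z ^ (2 ^ s)) + 2 * Z.ev g z) ^ 2"
      by (metis g power_Suc2 power_mult)
    also have "\<dots> = Z.ev p (z ^ 2 ^ s) ^ 2 + 4 * (Z.ev p (z ^ 2 ^ s) * Z.ev g z + Z.ev g z ^ 2)"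
      by (simp add: power2_eq_square algebra_simps)
    also have "\<dots> = Z.ev p (z ^ 2 ^ Suc s)
        + 2 * Z.ev (pcompose f X + 2 * (pcompose p X * g + g ^ 2)) z"
      by (simp add: f X_def two mult.commute algebra_simps flip: power_mult)
    finally show "Z.ev p z ^ (2 ^ Suc s) = Z.ev p (z ^ (2 ^ Suc s))
        + 2 * Z.ev (pcompose f X + 2 * (pcompose p X * g + g ^ 2)) z" .
  qed
qed

text \<open>By the pigeonhole principle two powers of \<open>a\<close> with different exponents
  agree modulo \<open>m\<close>; the lower one is coprime to \<open>m\<close> and cancels.\<close>

lemma power_cong_1_exists:
  fixes a m :: nat
  assumes "coprime a m" "m > 0"
  shows "\<exists>t>0. [a ^ t = 1] (mod m)"
proof -
  have "range (\<lambda>i. a ^ i mod m) \<subseteq> {..<m}" using assms by auto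
  hence "\<not> inj (\<lambda>i. a ^ i mod m)"
    using finite_subset finite_imageD infinite_UNIV_nat by blast
  then obtain i j where "i \<noteq> j" "a ^ i mod m = a ^ j mod m" by (auto simp: inj_def)
  hence "\<exists>i j. i < j \<and> [a ^ j = a ^ i] (mod m)"
    unfolding cong_def by (metis nat_neq_iff)
  then obtain i j where ij: "i < j" "[a ^ j = a ^ i] (mod m)" by blast
  hence "[a ^ i * a ^ (j - i) = a ^ i * 1] (mod m)" by (simp flip: power_add)
  moreover have "coprime (a ^ i) m" using assms by simp
  ultimately have "[a ^ (j - i) = 1] (mod m)" using cong_mult_lcancel_nat by blast
  thus ?thesis using ij by (intro exI[of _ "j - i"]) auto
qed

lemma odd_multiple_of_ii_notin_adjoin:
  fixes D :: int
  assumes m: "odd m" and \<zeta>: "\<zeta> ^ m = 1" and D: "odd D"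
  shows "of_int D * \<i> \<notin> Z.adjoin \<zeta>"
proof
  assume "of_int D * \<i> \<in> Z.adjoin \<zeta>"
  then obtain p where p: "of_int D * \<i> = Z.ev p \<zeta>" by (rule Z.adjoinE)
  have m0: "m > 0" using m by (auto intro: Nat.gr0I)
  obtain t where t: "t > 0" "[2 ^ t = 1] (mod m)"
    using power_cong_1_exists[of 2 m] m m0 by auto
  \<comment> \<open>Doubling \<open>t\<close> keeps \<open>e\<close> congruent to 1 modulo
    \<open>m\<close>, so that \<zeta>^e = \<zeta>, and makes 4 divide \<open>e\<close>, so that
    \<i>^e = 1.\<close>
  define s where "s = 2 * t"
  define e where "e = (2::nat) ^ s"
  have "[e = 1] (mod m)"
    using cong_pow[OF t(2), of 2] by (simp add: e_def s_def power_mult mult.commute[of 2])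
  hence \<zeta>e: "\<zeta> ^ e = \<zeta>"
    using power_mod_root[OF \<zeta>, of e] power_mod_root[OF \<zeta>, of 1] by (simp add: cong_def)
  have "(2::nat) ^ 2 dvd e" unfolding e_def s_def using t(1) by (intro le_imp_power_dvd) auto
  then obtain e' where e': "e = 4 * e'" by auto
  have ie: "\<i> ^ e = 1" by (simp add: e' power_mult)
  obtain g where "\<And>z. Z.ev p z ^ e = Z.ev p (z ^ e) + 2 * Z.ev g z"
    unfolding e_def using Z_frobenius[of p s] by blast
  from this[of \<zeta>] have g: "2 * Z.ev g \<zeta> = of_int (D ^ e) - of_int D * \<i>"
    by (simp add: \<zeta>e p [symmetric] power_mult_distrib ie)
  \<comment> \<open>The conjugate of \<zeta> is \<zeta>^(m-1), so \<int>[\<zeta>] is closed under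
    conjugation and contains the product \<open>x\<close> below.\<close>
  have cnj_ev: "cnj (Z.ev q z) = Z.ev q (cnj z)" for q z
    by (induction q) auto
  have "\<zeta> * cnj \<zeta> = 1"
    using \<zeta> m0 by (metis complex_mod_cnj complex_norm_square mult.commute norm_power norm_one
        of_real_1 power_eq_1_iff power_one norm_ge_zero zero_less_iff_neq_zero)
  moreover have "\<zeta> * \<zeta> ^ (m - 1) = 1" using \<zeta> m0 by (cases m) auto
  ultimately have cnj\<zeta>: "cnj \<zeta> = \<zeta> ^ (m - 1)"
    by (metis mult.commute mult.left_commute mult.right_neutral)
  define x where "x = Z.ev g \<zeta> * cnj (Z.ev g \<zeta>)"
  have "x \<in> Z.adjoin \<zeta>"
    unfolding x_def cnj_ev cnj\<zeta> by (intro Z.adjoin_mult Z.adjoin_ev Z.adjoin_poly Z.adjoin_power Z.adjoin_gen)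
  moreover have "4 * x = (2 * Z.ev g \<zeta>) * cnj (2 * Z.ev g \<zeta>)" by (simp add: x_def)
  hence x: "4 * x = of_int ((D ^ e) ^ 2 + D ^ 2)"
    unfolding g by (simp add: algebra_simps power2_eq_square)
  hence "x = of_int ((D ^ e) ^ 2 + D ^ 2) / 4"
    by (metis nonzero_mult_div_cancel_left zero_neq_numeral)
  hence "x \<in> \<rat>" by (metis Rats_divide Rats_number_of Rats_of_int)
  ultimately have "x \<in> \<int>" using \<zeta> m0 rat_in_adjoin_root_of_unity by blast
  then obtain c where "x = of_int c" by (auto elim: Ints_cases)
  with x have "of_int (4 * c) = (of_int ((D ^ e) ^ 2 + D ^ 2) :: complex)" by simp
  hence c: "4 * c = (D ^ e) ^ 2 + D ^ 2" by (simp only: of_int_eq_iff)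
  \<comment> \<open>Both squares in \<open>c\<close> are odd, so their sum is 2 modulo 4, whereas
    the left side is a multiple of 4.\<close>
  have "y ^ 2 mod 4 = 1" if "odd y" for y :: int
  proof -
    from that obtain b where "y = 2 * b + 1" by (elim oddE)
    hence "y ^ 2 = 1 + (b ^ 2 + b) * 4" by (simp add: power2_eq_square algebra_simps)
    thus ?thesis by (simp only: mod_mult_self1) simp
  qed
  from this[of "D ^ e"] this[of D] D c show False by simp presburger
qed

section \<open>Passing from \<rat>[\<zeta>] to \<int>[\<zeta>]\<close>

text \<open>X^m - 1 is squarefree: if d divides both factors, then d^2 divides it, so d divides its
  derivative m X^(m-1) and hence the unit m = m X^m - m (X^m - 1).\<close>

lemma coprime_factors_X_power_minus_1:
  fixes g h :: "rat poly"
  assumes "g * h = monom 1 m - 1" and m: "m > 0"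
  shows "coprime g h"
proof (rule coprimeI)
  fix d assume "d dvd g" "d dvd h"
  then obtain a b where ab: "g = d * a" "h = d * b" by (auto elim!: dvdE)
  have eq: "monom 1 m - 1 = d * (d * (a * b))"
    using assms(1) by (simp add: ab mult_ac)
  have "pderiv (monom 1 m - 1 :: rat poly) = monom (of_nat m) (m - 1)"
    by (simp add: pderiv_diff pderiv_monom)
  also have "pderiv (monom 1 m - 1) = d * (pderiv (d * (a * b)) + pderiv d * (a * b))"
    unfolding eq by (subst pderiv_mult) (simp add: algebra_simps)
  finally have "d dvd monom (of_nat m) (m - 1)" by (metis dvd_triv_left)
  hence "d dvd monom (of_nat m) (m - 1) * monom 1 1" by (rule dvd_mult2)
  also have "monom (of_nat m) (m - 1) * monom 1 1 = smult (of_nat m) (monom 1 m :: rat poly)"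
    using m by (simp add: mult_monom smult_monom)
  finally have "d dvd smult (of_nat m) (monom 1 m) - smult (of_nat m) (monom 1 m - 1)"
    by (intro dvd_diff) (auto simp: eq intro: dvd_smult)
  also have "\<dots> = [:of_nat m:]" by (simp add: smult_diff_right flip: one_pCons)
  finally have "d dvd [:of_nat m:]" .
  moreover have "is_unit [:of_nat m :: rat:]" using m by (simp add: is_unit_const_poly_iff dvd_field_iff)
  ultimately show "is_unit d" using dvd_trans by blast
qed

text \<open>
  If \<open>P(\<zeta>) = \<i>\<close>, multiplying \<open>P\<close> by the idempotent of \<open>\<rat>[X] / (X^m - 1)\<close> that belongs to the
  factor \<open>gcd (P^2 + 1) (X^m - 1)\<close> makes every value at an \<open>m\<close>-th root of unity integral.
\<close>
lemma ii_interpolation: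
  assumes m: "m > 0" and \<zeta>: "\<zeta> ^ m = 1" and P: "Q.ev P \<zeta> = \<i>"
  obtains u where "degree u < m" "Q.ev u \<zeta> = \<i>"
    "\<And>w. w ^ m = 1 \<Longrightarrow> Q.ev u w \<in> {0, \<i>, -\<i>}"
proof -
  define M where "M = (monom 1 m - 1 :: rat poly)"
  define g where "g = gcd (P ^ 2 + 1) M"
  obtain h where h: "M = g * h" unfolding g_def by (meson dvdE gcd_dvd2)
  obtain f where f: "P ^ 2 + 1 = g * f" unfolding g_def by (meson dvdE gcd_dvd1)
  have "coprime g h" using coprime_factors_X_power_minus_1[of g h m] h m by (simp add: M_def)
  \<comment> \<open>At m-th roots of unity, \<open>t * h\<close> is 1 where \<open>g\<close>
    vanishes and 0 where \<open>h\<close> vanishes.\<close>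
  then obtain s t where st: "s * g + t * h = 1"
    by (metis bezout_coefficients_fst_snd coprime_imp_gcd_eq_1)
  have root: "Q.ev M w = 0" if "w ^ m = 1" for w using that by (simp add: M_def)
  \<comment> \<open>By Bezout, \<open>g\<close> vanishes at an m-th root of unity exactly where
    \<open>P\<close> takes a value \<plusminus>\<i>.\<close>
  have g0: "Q.ev g z = 0 \<longleftrightarrow> Q.ev (P ^ 2 + 1) z = 0" if "z ^ m = 1" for z
  proof
    assume "Q.ev (P ^ 2 + 1) z = 0"
    moreover have "g = fst (bezout_coefficients (P ^ 2 + 1) M) * (P ^ 2 + 1)
        + snd (bezout_coefficients (P ^ 2 + 1) M) * M"
      unfolding g_def by (rule bezout_coefficients_fst_snd [symmetric])
    ultimately show "Q.ev g z = 0" using root[OF that] by (metis Q.ev_add Q.ev_mult mult_zero_right add_0)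
  qed (simp add: f del: Q.ev_add)
  \<comment> \<open>Reduction modulo \<open>M\<close> brings the degree below \<open>m\<close> and
    keeps the values at m-th roots of unity.\<close>
  define u where "u = (P * (t * h)) mod M"
  have degM: "degree M = m"
  proof -
    have "degree (monom 1 m + (- 1 :: rat poly)) = degree (monom 1 m :: rat poly)"
      using m by (intro degree_add_eq_left) (simp add: degree_monom_eq)
    thus ?thesis by (simp add: M_def degree_monom_eq)
  qed
  have ev_u: "Q.ev u w = Q.ev P w * Q.ev (t * h) w" if "w ^ m = 1" for w
  proof -
    have "Q.ev (P * (t * h)) w = Q.ev ((P * (t * h)) div M * M + u) w"
      unfolding u_def by (simp only: div_mult_mod_eq)
    thus ?thesis using root[OF that] by simp
  qed
  have ev_gh: "Q.ev g w = 0 \<Longrightarrow> Q.ev (t * h) w = 1" for w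
    using arg_cong[OF st, of "\<lambda>p. Q.ev p w"] by simp
  show thesis
  proof
    show "degree u < m" using degM m degree_mod_less'[of M "P * (t * h)"]
      by (cases "M = 0"; cases "u = 0") (auto simp: u_def)
    show "Q.ev u \<zeta> = \<i>" using ev_u[OF \<zeta>] g0[OF \<zeta>] ev_gh[of \<zeta>] P by simp
    fix w :: complex assume w: "w ^ m = 1"
    show "Q.ev u w \<in> {0, \<i>, -\<i>}"
    proof (cases "Q.ev g w = 0")
      case True
      hence "Q.ev P w ^ 2 + 1 = 0" using g0[OF w] by simp
      hence "(Q.ev P w - \<i>) * (Q.ev P w + \<i>) = 0" by (simp add: algebra_simps power2_eq_square)
      hence "Q.ev P w = \<i> \<or> Q.ev P w = -\<i>" by (auto simp: eq_neg_iff_add_eq_0)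
      thus ?thesis using ev_u[OF w] ev_gh[OF True] by auto
    next
      case False
      hence "Q.ev h w = 0" using root[OF w] by (simp add: h)
      thus ?thesis using ev_u[OF w] by simp
    qed
  qed
qed

lemma cis_root_power_eq_1_iff:
  assumes "m > 0"
  shows "cis (2 * pi / real m) ^ j = 1 \<longleftrightarrow> m dvd j"
proof -
  have "cis (2 * pi / real m) ^ j = cis (2 * pi * real j / real m)"
    by (simp add: Complex.DeMoivre mult_ac)
  also have "\<dots> = 1 \<longleftrightarrow> (\<exists>n::int. 2 * pi * real j / real m = 2 * pi * of_int n)"
    by (simp add: cis_eq_1_iff mult_ac)
  also have "\<dots> \<longleftrightarrow> (\<exists>n::int. real j = of_int n * real m)"
    using assms by (intro ex_cong1) (auto simp: field_simps)
  also have "\<dots> \<longleftrightarrow> (\<exists>n::int. int j = n * int m)"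
    by (intro ex_cong1) (metis of_int_eq_iff of_int_mult of_int_of_nat_eq)
  also have "\<dots> \<longleftrightarrow> int m dvd int j" by (auto simp: dvd_def mult.commute)
  finally show ?thesis by simp
qed

lemma sum_root_of_unity_powers:
  fixes z :: complex
  assumes "z ^ m = 1"
  shows "(\<Sum>j<m. z ^ j) = (if z = 1 then of_nat m else 0)"
proof (cases "z = 1")
  case False
  have "(1 - z) * (\<Sum>j<m. z ^ j) = 0" using one_diff_power_eq[of z m] assms by simp
  thus ?thesis using False by simp
qed simp

text \<open>
  By Fourier inversion, \<open>m\<close> times a coefficient of the interpolating polynomial is a rational number
  in \<open>\<int>[\<omega>]\<close>, for \<open>\<omega>\<close> of order \<open>4 m\<close>, hence an integer.
\<close>
lemma ii_in_Q_adjoin_imp_Z_adjoin: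
  assumes m: "m > 0" and i: "\<i> \<in> Q.adjoin (cis (2 * pi / real m))"
  shows "of_nat m * \<i> \<in> Z.adjoin (cis (2 * pi / real m))"
proof -
  define \<zeta> where "\<zeta> = cis (2 * pi / real m)"
  \<comment> \<open>Both \<zeta> = \<omega>^4 and \<i> = \<omega>^m are powers of this root, so
    \<int>[\<omega>] contains every term of the inversion formula.\<close>
  define \<omega> where "\<omega> = cis (2 * pi / real (4 * m))"
  have \<zeta>m: "\<zeta> ^ m = 1" and root: "\<zeta> ^ j = 1 \<longleftrightarrow> m dvd j" for j
    using m cis_root_power_eq_1_iff by (auto simp: \<zeta>_def)
  have \<omega>: "\<omega> ^ (4 * m) = 1" using m cis_root_power_eq_1_iff[of "4 * m" "4 * m"] by (simp add: \<omega>_def)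
  have \<zeta>\<omega>: "\<zeta> = \<omega> ^ 4" using m by (simp add: \<zeta>_def \<omega>_def Complex.DeMoivre)
  have "\<omega> ^ m = cis (pi / 2)" using m by (simp add: \<omega>_def Complex.DeMoivre)
  hence i\<omega>: "\<i> = \<omega> ^ m" by simp
  obtain P where "\<i> = Q.ev P \<zeta>" using i unfolding \<zeta>_def by (rule Q.adjoinE)
  then obtain u where u: "degree u < m" "Q.ev u \<zeta> = \<i>"
    "\<And>w. w ^ m = 1 \<Longrightarrow> Q.ev u w \<in> {0, \<i>, -\<i>}"
    using ii_interpolation[OF m \<zeta>m] by metis
  have Z_\<omega>: "\<zeta> ^ j \<in> Z.adjoin \<omega>" "\<i> \<in> Z.adjoin \<omega>" for j
    unfolding \<zeta>\<omega> i\<omega> by (intro Z.adjoin_power Z.adjoin_gen)+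
  have int: "of_nat m * of_rat (coeff u n) \<in> (\<int> :: complex set)" if n: "n < m" for n
  proof -
    \<comment> \<open>The exponent \<open>m - n\<close> stands for -n, as \<zeta>^m = 1;
      orthogonality of the roots of unity isolates the n-th coefficient.\<close>
    have "(\<Sum>j<m. Q.ev u (\<zeta> ^ j) * \<zeta> ^ (j * (m - n)))
        = (\<Sum>j<m. \<Sum>k<m. of_rat (coeff u k) * (\<zeta> ^ (k + (m - n))) ^ j)"
      unfolding Q.ev_altdef[OF u(1)] sum_distrib_right
      by (intro sum.cong refl) (simp add: algebra_simps flip: power_mult power_add)
    also have "\<dots> = (\<Sum>k<m. of_rat (coeff u k) * (\<Sum>j<m. (\<zeta> ^ (k + (m - n))) ^ j))"
      by (subst sum.swap) (simp add: sum_distrib_left)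
    also have "\<dots> = (\<Sum>k<m. of_rat (coeff u k) * (if k = n then of_nat m else 0))"
    proof (intro sum.cong refl arg_cong2[of _ _ _ _ "(*)"])
      fix k assume k: "k \<in> {..<m}"
      have "(\<zeta> ^ (k + (m - n))) ^ m = 1"
        by (metis \<zeta>m power_mult mult.commute power_one)
      moreover have "\<zeta> ^ (k + (m - n)) = 1 \<longleftrightarrow> k = n"
      proof -
        \<comment> \<open>The number \<open>k + (m - n)\<close> lies strictly between 0 and 2m, so
          \<open>m\<close> is the only multiple of \<open>m\<close> it can be.\<close>
        have "m dvd k + (m - n) \<longleftrightarrow> k + (m - n) = m"
        proof
          assume "m dvd k + (m - n)"
          then obtain c where c: "k + (m - n) = m * c" by (elim dvdE)
          moreover have "k + (m - n) < m * 2" "k + (m - n) > 0" using k n by auto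
          ultimately have "m * c < m * 2" "m * c > 0" by auto
          hence "c = 1" using mult_less_cancel1[of m c 2] by auto
          thus "k + (m - n) = m" using c by simp
        qed simp
        moreover have "k + (m - n) = m \<longleftrightarrow> k = n" using n by linarith
        ultimately show ?thesis by (simp only: root)
      qed
      ultimately show "(\<Sum>j<m. (\<zeta> ^ (k + (m - n))) ^ j) = (if k = n then of_nat m else 0)"
        by (simp add: sum_root_of_unity_powers)
    qed
    also have "\<dots> = of_nat m * of_rat (coeff u n)"
      using n by (simp add: if_distrib cong: if_cong)
    finally have eq: "of_nat m * of_rat (coeff u n) = (\<Sum>j<m. Q.ev u (\<zeta> ^ j) * \<zeta> ^ (j * (m - n)))" ..
    have "of_nat m * of_rat (coeff u n) \<in> Z.adjoin \<omega>"
      unfolding eq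
    proof (intro Z.adjoin_sum Z.adjoin_mult Z_\<omega>)
      fix j
      have "(\<zeta> ^ j) ^ m = 1" by (metis \<zeta>m power_mult mult.commute power_one)
      from u(3)[OF this] show "Q.ev u (\<zeta> ^ j) \<in> Z.adjoin \<omega>"
        using Z_\<omega>(2) by auto
    qed
    thus ?thesis using m by (intro rat_in_adjoin_root_of_unity[OF \<omega>]) auto
  qed
  have "of_nat m * \<i> = (\<Sum>n<m. (of_nat m * of_rat (coeff u n)) * \<zeta> ^ n)"
    unfolding u(2) [symmetric] Q.ev_altdef[OF u(1)] by (simp add: sum_distrib_left mult_ac)
  also have "\<dots> \<in> Z.adjoin \<zeta>"
  proof (rule Z.adjoin_sum)
    fix n assume "n \<in> {..<m}"
    hence "of_nat m * of_rat (coeff u n) \<in> Z.adjoin \<zeta>"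
      using int[of n] by (metis Ints_cases Z.adjoin_base lessThan_iff)
    thus "of_nat m * of_rat (coeff u n) * \<zeta> ^ n \<in> Z.adjoin \<zeta>"
      by (rule Z.adjoin_mult) (intro Z.adjoin_power Z.adjoin_gen)
  qed
  finally show ?thesis by (simp add: \<zeta>_def)
qed

lemma ii_notin_odd_cyclotomic:
  assumes "odd m"
  shows "\<i> \<notin> Q.adjoin (cis (2 * pi / real m))"
proof
  have m: "m > 0" using assms by (auto intro: Nat.gr0I)
  assume "\<i> \<in> Q.adjoin (cis (2 * pi / real m))"
  hence "of_nat m * \<i> \<in> Z.adjoin (cis (2 * pi / real m))" by (rule ii_in_Q_adjoin_imp_Z_adjoin[OF m])
  moreover have "cis (2 * pi / real m) ^ m = 1" using m by (simp add: cis_root_power_eq_1_iff)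
  ultimately show False
    using odd_multiple_of_ii_notin_adjoin[of m _ "int m"] assms by auto
qed

text \<open>If q = 2m with m odd, then e^(2\<pi>\<i>/q) = -(e^(2\<pi>\<i>/m))^((m+1)/2), which
  reduces the even case to the odd one.\<close>

lemma ii_notin_cyclotomic:
  assumes "q > 0" "\<not> 4 dvd q"
  shows "\<i> \<notin> Q.adjoin (cis (2 * pi / real q))"
proof (cases "odd q")
  case False
  then obtain m where m: "q = 2 * m" by (auto elim: evenE)
  have "odd m" using assms m by auto
  then obtain l where l: "m = 2 * l + 1" by (elim oddE)
  have "real (Suc l) * (2 * pi / real m) = pi + 2 * pi / real q"
  proof -
    have M: "real m = 2 * real l + 1" "real m \<noteq> 0" using l by simp_all
    have "real (Suc l) * (2 * pi / real m) = pi * (real m + 1) / real m"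
      unfolding M(1) by (simp add: mult_ac distrib_left)
    also have "\<dots> = pi + 2 * pi / real q"
      using M(2) by (simp add: m distrib_left add_divide_distrib)
    finally show ?thesis .
  qed
  hence "cis (2 * pi / real m) ^ Suc l = cis (pi + 2 * pi / real q)"
    by (simp only: Complex.DeMoivre)
  also have "\<dots> = - cis (2 * pi / real q)" by (simp flip: cis_mult)
  finally have "cis (2 * pi / real q) = - (cis (2 * pi / real m) ^ Suc l)" by simp
  hence "cis (2 * pi / real q) \<in> Q.adjoin (cis (2 * pi / real m))"
    by (metis Q.adjoin_gen Q.adjoin_minus Q.adjoin_power)
  thus ?thesis using ii_notin_odd_cyclotomic[OF \<open>odd m\<close>] Q.adjoin_trans by blast
qed (rule ii_notin_odd_cyclotomic)

section \<open>The Hurwitz zeta function at rational points\<close>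

lemma sin_pi_mult_eq_0_iff:
  fixes z :: complex
  shows "sin (of_real pi * z) = 0 \<longleftrightarrow> z \<in> \<int>"
proof -
  have "sin (of_real pi * z) = 0 \<longleftrightarrow> (\<exists>n::int. of_real pi * z = of_real pi * of_int n)"
    by (simp add: Complex_Transcendental.sin_eq_0 mult.commute)
  also have "\<dots> \<longleftrightarrow> z \<in> \<int>" by (auto elim: Ints_cases)
  finally show ?thesis .
qed

lemma notin_Ints_imp_notin_nonpos_Ints:
  fixes z :: complex
  assumes "z \<notin> \<int>"
  shows "z \<notin> \<int>\<^sub>\<le>\<^sub>0" "1 - z \<notin> \<int>\<^sub>\<le>\<^sub>0"
proof -
  have "1 - z \<notin> \<int>" using assms Ints_diff[of 1 "1 - z"] by auto
  thus "z \<notin> \<int>\<^sub>\<le>\<^sub>0" "1 - z \<notin> \<int>\<^sub>\<le>\<^sub>0" using assms nonpos_Ints_Int by auto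
qed

lemma open_compl_Ints: "open (- \<int> :: complex set)"
  using closed_Ints by (simp add: open_closed)

text \<open>This is the logarithmic derivative of Gamma(z) Gamma(1 - z) sin(\<pi>z) = \<pi>, which
  holds on the open complement of the integers.\<close>

lemma Digamma_reflection:
  fixes z :: complex
  assumes z: "z \<notin> \<int>"
  shows "Digamma (1 - z) - Digamma z = of_real pi * cot (of_real pi * z)"
proof -
  let ?s = "sin (of_real pi * z)"
  define f where "f w = Gamma w * Gamma (1 - w) * sin (of_real pi * w)" for w :: complex
  note nz = notin_Ints_imp_notin_nonpos_Ints[OF z]
  have "(f has_field_derivative
      (Gamma z * Gamma (1 - z) * (?s * (Digamma z - Digamma (1 - z)) + of_real pi * cos (of_real pi * z)))) (at z)"
    unfolding f_def using nz
    by (auto intro!: derivative_eq_intros simp: algebra_simps)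
  moreover have "(f has_field_derivative 0) (at z)"
  proof (rule has_field_derivative_transform_within_open[OF _ open_compl_Ints])
    show "((\<lambda>_. of_real pi) has_field_derivative 0) (at z)" by (rule DERIV_const)
    fix w :: complex assume "w \<in> - \<int>"
    thus "of_real pi = f w"
      by (simp add: f_def Gamma_reflection_complex sin_pi_mult_eq_0_iff)
  qed (use z in auto)
  ultimately have "Gamma z * Gamma (1 - z) *
      (?s * (Digamma z - Digamma (1 - z)) + of_real pi * cos (of_real pi * z)) = 0"
    by (rule DERIV_unique)
  hence "?s * (Digamma z - Digamma (1 - z)) + of_real pi * cos (of_real pi * z) = 0"
    using nz by (simp add: Gamma_eq_zero_iff)
  thus ?thesis using z sin_pi_mult_eq_0_iff[of z]
    by (simp add: cot_def divide_simps) (simp add: algebra_simps)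
qed

text \<open>
  The cotangent is normalised to \<open>-\<i> cot (\<pi> z) = (w + 1) / (w - 1)\<close>, with \<open>w = e^(2\<pi>\<i>z)\<close>, because this
  value is cyclotomic for rational \<open>z\<close>; it satisfies \<open>C' = \<i> \<pi> (1 - C^2)\<close>.
\<close>
lemma Polygamma_reflection:
  "\<exists>r. \<forall>z. z \<notin> \<int> \<longrightarrow> (-1) ^ n * Polygamma n (1 - z) - Polygamma n z
      = (\<i> * of_real pi) ^ Suc n * Q.ev r (- \<i> * cot (of_real pi * z))"
proof (induction n)
  case 0
  show ?case
    \<comment> \<open>The witness is X because \<pi> cot(\<pi>z) = \<i>\<pi> C(z).\<close>
    by (rule exI[of _ "[:0, 1:]"]) (simp add: Digamma_reflection algebra_simps flip: mult.assoc)
next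
  case (Suc n)
  define C where "C z = - \<i> * cot (of_real pi * z)" for z :: complex
  obtain r where r: "\<And>z. z \<notin> \<int> \<Longrightarrow> (-1) ^ n * Polygamma n (1 - z) - Polygamma n z
      = (\<i> * of_real pi) ^ Suc n * Q.ev r (C z)"
    using Suc.IH unfolding C_def by blast
  show ?case
  \<comment> \<open>By the chain rule and the equation for C', differentiating r(C) gives \<i>\<pi>
    (1 - C^2) r'(C).\<close>
  proof (intro exI[of _ "(1 - monom 1 2) * pderiv r"] allI impI)
    fix z :: complex assume z: "z \<notin> \<int>"
    note nz = notin_Ints_imp_notin_nonpos_Ints[OF z]
    let ?s = "sin (of_real pi * z)" and ?c = "cos (of_real pi * z)"
    have s: "?s \<noteq> 0" using z by (simp add: sin_pi_mult_eq_0_iff)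
    have C': "(C has_field_derivative \<i> * of_real pi * (1 - C z ^ 2)) (at z)"
    proof -
      have "1 - C z ^ 2 = inverse (?s ^ 2)"
        using s sin_cos_squared_add[of "of_real pi * z"]
        by (simp add: C_def cot_def power_mult_distrib field_simps)
      moreover have "(C has_field_derivative \<i> * of_real pi * inverse (?s ^ 2)) (at z)"
        unfolding C_def using s
        by (auto intro!: derivative_eq_intros DERIV_chain2[OF DERIV_cot])
      ultimately show ?thesis by simp
    qed
    have ev': "(Q.ev p has_field_derivative Q.ev (pderiv p) x) (at x)" for p x
    proof -
      have "map_poly of_rat (pderiv p) = pderiv (map_poly of_rat p :: complex poly)"
        by (rule poly_eqI) (simp add: coeff_pderiv coeff_map_poly of_rat_mult of_rat_add)
      thus ?thesis using poly_DERIV[of "map_poly of_rat p" x] unfolding Q.ev_def by simp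
    qed
    have "((\<lambda>z. (\<i> * of_real pi) ^ Suc n * Q.ev r (C z)) has_field_derivative
        (\<i> * of_real pi) ^ Suc n * (Q.ev (pderiv r) (C z) * (\<i> * of_real pi * (1 - C z ^ 2)))) (at z)"
      by (intro DERIV_cmult DERIV_chain2[OF ev'] C')
    moreover have "((\<lambda>z. (\<i> * of_real pi) ^ Suc n * Q.ev r (C z)) has_field_derivative
        (-1) ^ Suc n * Polygamma (Suc n) (1 - z) - Polygamma (Suc n) z) (at z)"
    proof (rule has_field_derivative_transform_within_open[OF _ open_compl_Ints])
      show "((\<lambda>z. (-1) ^ n * Polygamma n (1 - z) - Polygamma n z) has_field_derivative
        (-1) ^ Suc n * Polygamma (Suc n) (1 - z) - Polygamma (Suc n) z) (at z)"
        using nz by (auto intro!: derivative_eq_intros)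
    qed (use z r in auto)
    ultimately have "(-1) ^ Suc n * Polygamma (Suc n) (1 - z) - Polygamma (Suc n) z
       = (\<i> * of_real pi) ^ Suc n * (Q.ev (pderiv r) (C z) * (\<i> * of_real pi * (1 - C z ^ 2)))"
      by (rule DERIV_unique [symmetric])
    also have "\<dots> = (\<i> * of_real pi) ^ Suc (Suc n) * Q.ev ((1 - monom 1 2) * pderiv r) (C z)"
      by simp
    finally show "(-1) ^ Suc n * Polygamma (Suc n) (1 - z) - Polygamma (Suc n) z
       = (\<i> * of_real pi) ^ Suc (Suc n) * Q.ev ((1 - monom 1 2) * pderiv r) (- \<i> * cot (of_real pi * z))"
      by (simp only: C_def)
  qed
qed

section \<open>Zeta values in terms of roots of unity\<close>

text \<open>Positivity of \<open>x\<close> keeps every base nonzero, so \<open>powr\<close> with an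
  integer exponent is an ordinary power and the two series agree termwise up to the
  constant.\<close>

lemma hurwitz_zeta_conv_Polygamma:
  assumes "x > 0"
  shows "Polygamma (Suc n) (of_real x)
    = (-1) ^ n * fact (Suc n) * hurwitz_zeta (of_nat (Suc (Suc n))) x"
proof -
  have "(of_nat k + of_real x) powr (- of_nat (Suc (Suc n)))
      = inverse ((of_real x + of_nat k) ^ Suc (Suc n) :: complex)" for k
  proof -
    have "of_nat k + of_real x = complex_of_real (real k + x)" by simp
    moreover have "real k + x \<noteq> 0" using assms by (simp add: add_nonneg_eq_0_iff)
    ultimately have "of_nat k + of_real x \<noteq> (0 :: complex)" by (metis of_real_eq_0_iff)
    thus ?thesis by (simp add: powr_minus powr_nat add.commute del: of_nat_Suc power_Suc)
  qed
  thus ?thesis by (simp add: Polygamma_def hurwitz_zeta_def del: of_nat_Suc power_Suc fact_Suc)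
      (simp add: power_Suc)
qed

text \<open>Euler's formulas express both sides through the half-angle value w = cis(\<pi>x);
  expanding the fraction by w and using \<open>w * cnj w = 1\<close> leaves only w^2.\<close>

lemma minus_ii_cot_conv_cis:
  assumes "x \<notin> \<int>"
  shows "- \<i> * cot (of_real pi * of_real x) = (cis (2 * pi * x) + 1) / (cis (2 * pi * x) - 1)"
proof -
  define w where "w = cis (pi * x)"
  have w: "w * cnj w = 1" by (simp add: w_def cis_cnj cis_mult)
  have w0: "w \<noteq> 0" by (simp add: w_def)
  have "cos (of_real pi * of_real x) = complex_of_real (cos (pi * x))"
    by (metis cos_of_real of_real_mult)
  hence cos: "cos (of_real pi * of_real x) = (w + cnj w) / 2"
    by (simp add: w_def complex_eq_iff)
  have "sin (of_real pi * of_real x) = complex_of_real (sin (pi * x))"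
    by (metis sin_of_real of_real_mult)
  hence sin: "sin (of_real pi * of_real x) = (w - cnj w) / (2 * \<i>)"
    by (simp add: w_def complex_eq_iff)
  have "sin (of_real pi * of_real x :: complex) \<noteq> 0"
    using assms unfolding sin_pi_mult_eq_0_iff by (metis Ints_cases Ints_of_int of_real_eq_iff of_real_of_int_eq)
  hence ne: "w - cnj w \<noteq> 0" unfolding sin by auto
  have "- \<i> * cot (of_real pi * of_real x) = (w + cnj w) / (w - cnj w)"
    using ne by (simp add: cot_def cos sin)
  also have "\<dots> = (w * (w + cnj w)) / (w * (w - cnj w))" using w0 by simp
  also have "\<dots> = (w ^ 2 + 1) / (w ^ 2 - 1)" by (simp add: algebra_simps w power2_eq_square)
  also have "w ^ 2 = cis (2 * pi * x)" by (simp add: w_def Complex.DeMoivre mult_ac)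
  finally show ?thesis .
qed

text \<open>With this formula, no closure of \<open>\<rat>[w]\<close> under inverses is needed.\<close>
lemma inverse_root_of_unity_minus_1:
  fixes w :: complex
  assumes "w ^ q = 1" "w \<noteq> 1" "q > 0"
  shows "inverse (w - 1) = (\<Sum>j<q. of_nat j * w ^ j) / of_nat q"
proof -
  \<comment> \<open>The identity is proved for all \<open>n\<close> by induction; at n = q the
    geometric sum vanishes and w^q = 1.\<close>
  have "(w - 1) * (\<Sum>j<n. of_nat j * w ^ j) = of_nat n * w ^ n - w * (\<Sum>j<n. w ^ j)" for n
    by (induction n) (simp_all add: algebra_simps)
  from this[of q] have "(w - 1) * (\<Sum>j<q. of_nat j * w ^ j) = of_nat q"
    using assms by (simp add: sum_root_of_unity_powers)
  thus ?thesis using assms by (simp add: field_simps)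
qed

text \<open>Oddness of \<open>k\<close> enters twice: it gives the reflection formula the signs of a
  difference of zeta values, and it makes \<i>^k equal to \<plusminus>\<i>, the source of the factor
  \<i>.\<close>

lemma hurwitz_zeta_diff_in_adjoin:
  fixes k q a :: nat
  assumes k: "k > 1" "odd k" and a: "0 < a" "a < q"
  shows "((hurwitz_zeta (of_nat k) (real a / real q) - hurwitz_zeta (of_nat k) (1 - real a / real q))
      / of_real pi ^ k) \<in> (*) \<i> ` Q.adjoin (cis (2 * pi / real q))"
proof -
  define x where "x = real a / real q"
  define \<zeta> where "\<zeta> = cis (2 * pi / real q)"
  define w where "w = cis (2 * pi * x)"
  have x: "0 < x" "x < 1" using a by (auto simp: x_def)
  obtain n where n: "k = Suc (Suc n)" using k by (metis Suc_lessE One_nat_def less_imp_Suc_add plus_1_eq_Suc)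
  have n_odd: "odd n" using k n by simp
  obtain r where r: "\<And>z. z \<notin> \<int> \<Longrightarrow> (-1) ^ Suc n * Polygamma (Suc n) (1 - z) - Polygamma (Suc n) z
      = (\<i> * of_real pi) ^ k * Q.ev r (- \<i> * cot (of_real pi * z))"
    using Polygamma_reflection[of "Suc n"] unfolding n by blast
  have x_int: "x \<notin> \<int>" using x by (auto elim!: Ints_cases)
  hence "(of_real x :: complex) \<notin> \<int>"
    by (metis Ints_cases Ints_of_int of_real_eq_iff of_real_of_int_eq)
  from r[OF this, unfolded minus_ii_cot_conv_cis[OF x_int], folded w_def]
  have "fact (Suc n) * (hurwitz_zeta (of_nat k) x - hurwitz_zeta (of_nat k) (1 - x))
      = (\<i> * of_real pi) ^ k * Q.ev r ((w + 1) / (w - 1))"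
    using hurwitz_zeta_conv_Polygamma[of x n] hurwitz_zeta_conv_Polygamma[of "1 - x" n] x n_odd
    by (simp add: n algebra_simps del: of_nat_Suc power_Suc fact_Suc)
  hence "(hurwitz_zeta (of_nat k) x - hurwitz_zeta (of_nat k) (1 - x)) / of_real pi ^ k
      = \<i> ^ k * (Q.ev r ((w + 1) / (w - 1)) / fact (Suc n))"
    by (simp add: field_simps power_mult_distrib del: fact_Suc)
  also have "\<dots> = \<i> * ((-1) ^ (k div 2) * (Q.ev r ((w + 1) / (w - 1)) * of_rat (1 / fact (Suc n))))"
  proof -
    obtain l where "k = 2 * l + 1" using k(2) by (elim oddE)
    hence "\<i> ^ k = \<i> * (-1) ^ (k div 2)" by (simp add: power_mult)
    moreover have "of_rat (fact (Suc n)) = (fact (Suc n) :: complex)"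
      by (metis of_nat_fact of_rat_of_nat_eq)
    ultimately show ?thesis by (simp add: of_rat_divide del: fact_Suc)
  qed
  also have "\<dots> \<in> (*) \<i> ` Q.adjoin \<zeta>"
  proof (intro imageI Q.adjoin_mult Q.adjoin_power Q.adjoin_base Q.adjoin_poly Q.adjoin_minus Q.adjoin_1)
    have w\<zeta>: "w = \<zeta> ^ a" by (simp add: w_def \<zeta>_def x_def Complex.DeMoivre mult_ac)
    have wq: "w ^ q = 1"
      using a cis_root_power_eq_1_iff[of q q]
      by (metis \<zeta>_def w\<zeta> dvd_refl gr_implies_not0 mult.commute neq0_conv power_mult power_one)
    have w1: "w \<noteq> 1"
      using a cis_root_power_eq_1_iff[of q a] by (auto simp: w\<zeta> \<zeta>_def dest: dvd_imp_le)
    have "inverse (w - 1) = of_rat (1 / of_nat q) * (\<Sum>j<q. of_rat (of_nat j) * w ^ j)"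
      using inverse_root_of_unity_minus_1[OF wq w1] a by (simp add: of_rat_divide)
    also have "\<dots> \<in> Q.adjoin \<zeta>"
      unfolding w\<zeta> by (intro Q.adjoin_mult Q.adjoin_sum Q.adjoin_power Q.adjoin_base Q.adjoin_gen)
    finally have "inverse (w - 1) \<in> Q.adjoin \<zeta>" .
    thus "(w + 1) / (w - 1) \<in> Q.adjoin \<zeta>"
      unfolding divide_inverse w\<zeta> by (intro Q.adjoin_mult Q.adjoin_add Q.adjoin_power Q.adjoin_gen Q.adjoin_1)
  qed
  finally show ?thesis by (simp add: x_def \<zeta>_def)
qed

theorem theorem5p4:
  fixes k q :: nat
  assumes "k > 1" and "odd k"
    and "q > 2" and "\<not> 4 dvd q"
  shows "rat_span {(hurwitz_zeta (of_nat k) (real a / real q)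
                      - hurwitz_zeta (of_nat k) (1 - real a / real q)) / of_real pi ^ k
                    | a :: nat. 1 \<le> a \<and> real a < real q / 2 \<and> coprime a q}
           \<inter> \<rat> = {0}"
    (is "rat_span ?S \<inter> \<rat> = {0}")
proof -
  let ?K = "Q.adjoin (cis (2 * pi / real q))"
  have "?S \<subseteq> (*) \<i> ` ?K"
    using hurwitz_zeta_diff_in_adjoin[OF assms(1,2)] assms(3) by (auto simp del: times_divide_eq_left)
  moreover have "rat_complex.subspace ((*) \<i> ` ?K)"
  proof (rule rat_complex.subspaceI)
    show "0 \<in> (*) \<i> ` ?K" using image_eqI[of 0 "(*) \<i>" 0 ?K] by simp
  next
    fix x y assume "x \<in> (*) \<i> ` ?K" "y \<in> (*) \<i> ` ?K"
    then obtain u v where "x = \<i> * u" "y = \<i> * v" "u \<in> ?K" "v \<in> ?K" by blast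
    thus "x + y \<in> (*) \<i> ` ?K" by (intro image_eqI[of _ _ "u + v"]) (auto simp: algebra_simps)
  next
    fix c x assume "x \<in> (*) \<i> ` ?K"
    then obtain u where "x = \<i> * u" "u \<in> ?K" by blast
    thus "of_rat c * x \<in> (*) \<i> ` ?K" by (intro image_eqI[of _ _ "of_rat c * u"]) auto
  qed
  ultimately have span: "rat_span ?S \<subseteq> (*) \<i> ` ?K" by (rule rat_complex.span_minimal)
  have "z = 0" if z: "z \<in> rat_span ?S" "z \<in> \<rat>" for z
  proof (rule ccontr)
    assume "z \<noteq> 0"
    obtain u where u: "z = \<i> * u" "u \<in> ?K" using span z(1) by blast
    obtain r where r: "z = of_rat r" using z(2) by (auto elim: Rats_cases)
    \<comment> \<open>Since z = \<i> u, the quotient -u/z equals \<i>, and dividing by the nonzero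
      rational z stays in \<open>?K\<close>.\<close>
    have "of_rat (- 1 / r) * u \<in> ?K" using u(2) by blast
    also have "of_rat (- 1 / r) * u = - u / z" by (simp add: r of_rat_divide of_rat_minus)
    also have "\<dots> = \<i>" using \<open>z \<noteq> 0\<close> by (simp add: u(1) field_simps)
    finally show False using ii_notin_cyclotomic[of q] assms by simp
  qed
  moreover have "0 \<in> rat_span ?S" by (rule rat_complex.span_zero)
  ultimately show ?thesis by auto
qed

end
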